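(* Let $n\ge 2$ and let $(U_n(\ell),\,1\le \ell\le n)$ be independent random variables such that $U_n(\ell)$ is uniformly distributed on $\{1,\ldots,n\}\setminus\{\ell\}$. Let $\mathscr{F}_n^*$ be the random directed forest on $\{1,\ldots,n\}$ such that, for all $k,\ell$, there is an edge from $k$ to $\ell$ if and only if $k<\ell$ and $U_n(\ell)=k$. Then the random forest obtained by relabeling the vertices of $\mathscr{F}_n^*$ according to a uniform permutation of $\{1,\ldots,n\}$ (independent of $\mathscr{F}_n^*$) is distributed as the Moran forest $\mathscr{F}_n$.
   Context: Moran forest: for fixed $n\ge 2$, consider the Markov chain on directed graphs on $\{1,\ldots,n\}$ whose transitions are: at each time-step, choose an ordered pair of distinct vertices $(u,v)$ uniformly at random; disconnect $v$ from all of its neighbors (remove all edges incident to $v$), then add the edge $\vec{uv}$. This chain has a unique stationary distribution, whose support is the set of non-empty rooted forests (those with at least one edge) on $\{1,\ldots,n\}$, with edges pointing away from the roots. The Moran forest $\mathscr{F}_n$ is a random forest having this stationary distribution. *)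

theory Defs
  imports "HOL-Probability.Probability" "HOL-Combinatorics.Permutations"
begin

text \<open>
  A directed graph on the fixed vertex set \<open>{1..n}\<close> is represented by its set of edges; the pair
  \<open>(u, v)\<close> is the edge from \<open>u\<close> to \<open>v\<close>. Graphs are simple: no loops.
\<close>

type_synonym digraph = "(nat \<times> nat) set"

definition vertex_pairs :: "nat \<Rightarrow> (nat \<times> nat) set" where
  "vertex_pairs n = {(u, v). u \<in> {1..n} \<and> v \<in> {1..n} \<and> u \<noteq> v}"

definition digraphs_on :: "nat \<Rightarrow> digraph set" where
  "digraphs_on n = Pow (vertex_pairs n)"

definition disconnect :: "nat \<Rightarrow> digraph \<Rightarrow> digraph" where
  "disconnect v G = {(a, b) \<in> G. a \<noteq> v \<and> b \<noteq> v}"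

definition moran_step :: "nat \<Rightarrow> digraph \<Rightarrow> digraph pmf" where
  "moran_step n G =
     map_pmf (\<lambda>(u, v). insert (u, v) (disconnect v G)) (pmf_of_set (vertex_pairs n))"

definition moran_stationary :: "nat \<Rightarrow> digraph pmf \<Rightarrow> bool" where
  "moran_stationary n \<mu> \<longleftrightarrow> set_pmf \<mu> \<subseteq> digraphs_on n \<and> bind_pmf \<mu> (moran_step n) = \<mu>"

text \<open>
  The law of the Moran forest. The description operator is meaningful for \<open>n \<ge> 2\<close>, where the
  stationary distribution exists and is unique.
\<close>

definition moran_forest :: "nat \<Rightarrow> digraph pmf" where
  "moran_forest n = (THE \<mu>. moran_stationary n \<mu>)"

definition attachment_forest :: "nat \<Rightarrow> (nat \<Rightarrow> nat) \<Rightarrow> digraph" where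
  "attachment_forest n u = {(k, l). k \<in> {1..n} \<and> l \<in> {1..n} \<and> k < l \<and> u l = k}"

text \<open>Vertex \<open>v\<close> receives the new label \<open>p v\<close>.\<close>

definition relabel :: "(nat \<Rightarrow> nat) \<Rightarrow> digraph \<Rightarrow> digraph" where
  "relabel p G = map_prod p p ` G"

text \<open>
  The library's \<open>indep_var\<close> forces both random variables to have the same type; this is
  its characterization \<open>indep_var_eq\<close>, through the generated sigma-algebras, for two types.
\<close>

definition (in prob_space) indep_rvs ::
    "'b measure \<Rightarrow> ('a \<Rightarrow> 'b) \<Rightarrow> 'c measure \<Rightarrow> ('a \<Rightarrow> 'c) \<Rightarrow> bool" where
  "indep_rvs S X T Y \<longleftrightarrow> random_variable S X \<and> random_variable T Y \<and>
     indep_set (sets (vimage_algebra (space M) X S)) (sets (vimage_algebra (space M) Y T))"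

end

theory Submission
  imports Defs
begin

text \<open>
  In a long run of the Moran chain, give each vertex \<open>v\<close> the mother \<open>m v\<close> that it received
  when it was last reattached, and rank the vertices by the times of these last reattachments. An
  edge from \<open>m v\<close> to \<open>v\<close> is present iff \<open>m v\<close> has not been reattached after \<open>v\<close>, that is, iff
  the mother has the smaller rank. Hence the graph is a function of the pair of a ranking and a
  mother function (lemma \<open>reattach_ranked_forest\<close>).

  The pair itself evolves simply: a uniform vertex moves to the top rank and draws a new mother.
  The uniform distribution on pairs is preserved, because moving a uniform element to the top preserves
  the uniform permutation (\<open>promote_uniform_ranking\<close>) and because redrawing one coordinate of an
  independent family does not change its law (\<open>refresh_uniform_mothers\<close>). Its image is therefore
  stationary for the Moran chain (\<open>moran_stationary_ranked_forest_law\<close>).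

  The relabeled attachment forest is this image. The labels of the attachment forest are the ranks,
  the uniform relabeling \<open>p\<close> is the inverse of the ranking, and conjugating the variables \<open>U\<^sub>n\<close> by
  \<open>p\<close> gives mothers that are again uniform and independent of \<open>p\<close> (\<open>relabel_attachment_law\<close>).

  The stationary distribution is unique because reattaching all vertices one after the other erases
  the initial graph: a fixed word of \<open>n\<close> moves, of positive probability, sends all digraphs to the
  same one (\<open>moran_stationary_unique\<close>).
\<close>

section \<open>Uniqueness by synchronising random maps\<close>

text \<open>
  Two chains driven by the same random maps: \<open>F w0\<close> merges them, so conditioning on the map \<open>w\<close>
  shows that the largest difference \<open>D\<close> of the probabilities that the two laws assign to an event
  satisfies \<open>D \<le> (1 - pmf Q w0) * D\<close>.
\<close>

lemma stationary_le_of_synchronizing_map: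
  fixes Q :: "'w pmf" and F :: "'w \<Rightarrow> 's \<Rightarrow> 's"
  assumes st: "bind_pmf Q (\<lambda>w. map_pmf (F w) \<mu>) = \<mu>" "bind_pmf Q (\<lambda>w. map_pmf (F w) \<nu>) = \<nu>"
    and w0: "w0 \<in> set_pmf Q"
    and sync: "\<And>x. x \<in> set_pmf \<mu> \<union> set_pmf \<nu> \<Longrightarrow> F w0 x = c"
  shows "measure_pmf.prob \<mu> S \<le> measure_pmf.prob \<nu> S"
proof -
  define d where "d S = measure_pmf.prob \<mu> S - measure_pmf.prob \<nu> S" for S
  define D where "D = (SUP S. d S)"
  have d_le: "d S \<le> 1" for S
    unfolding d_def using measure_pmf.prob_le_1[of \<mu> S] measure_nonneg[of \<nu> S] by linarith
  have bdd: "bdd_above (range d)"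
    using d_le by (intro bdd_aboveI[of _ 1]) auto
  have d_le_D: "d S \<le> D" for S
    unfolding D_def by (rule cSUP_upper[OF _ bdd]) simp
  have bind_prob: "measure_pmf.prob (bind_pmf Q (\<lambda>w. map_pmf (F w) \<rho>)) S
      = measure_pmf.expectation Q (\<lambda>w. measure_pmf.prob \<rho> (F w -` S))" for \<rho> S
    unfolding measure_pmf_bind
    by (subst measure_pmf.measure_bind[where N = "count_space UNIV"])
      (auto simp: measure_pmf_in_subprob_algebra)
  have integrable: "integrable (measure_pmf Q) (\<lambda>w. measure_pmf.prob \<rho> (F w -` S))" for \<rho> S
    by (rule measure_pmf.integrable_const_bound[where B = 1]) auto
  have point_mass: "integrable (measure_pmf Q) (\<lambda>w. D * indicator {w0} w)"
    by (intro Bochner_Integration.integrable_mult_right integrable_real_indicator)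
      (auto simp: less_top[symmetric])
  have merged: "d (F w0 -` S) = 0" for S
  proof -
    have "measure_pmf.prob \<rho> (F w0 -` S) = indicator S c" if "set_pmf \<rho> \<subseteq> set_pmf \<mu> \<union> set_pmf \<nu>" for \<rho>
    proof -
      have "measure_pmf.prob \<rho> (F w0 -` S) = measure_pmf.prob \<rho> (if c \<in> S then UNIV else {})"
        using that sync by (intro measure_pmf.finite_measure_eq_AE) (auto simp: AE_measure_pmf_iff)
      then show ?thesis by simp
    qed
    then show ?thesis by (simp add: d_def)
  qed
  have contraction: "d S \<le> (1 - pmf Q w0) * D" for S
  proof -
    have "d S = measure_pmf.expectation Q (\<lambda>w. d (F w -` S))"
      using arg_cong[OF st(1), of "\<lambda>\<rho>. measure_pmf.prob \<rho> S"]
        arg_cong[OF st(2), of "\<lambda>\<rho>. measure_pmf.prob \<rho> S"]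
      unfolding bind_prob d_def by (simp add: integrable)
    \<comment> \<open>every map gives at most \<open>D\<close>, and the merging map \<open>w0\<close> gives \<open>0\<close>\<close>
    also have "\<dots> \<le> measure_pmf.expectation Q (\<lambda>w. D - D * indicator {w0} w)"
    proof (rule integral_mono)
      show "integrable (measure_pmf Q) (\<lambda>w. d (F w -` S))"
        unfolding d_def by (intro Bochner_Integration.integrable_diff integrable)
      show "integrable (measure_pmf Q) (\<lambda>w. D - D * indicator {w0} w)"
        by (intro Bochner_Integration.integrable_diff point_mass measure_pmf.integrable_const)
      show "d (F w -` S) \<le> D - D * indicator {w0} w" for w
        using d_le_D[of "F w -` S"] merged[of S] by (cases "w = w0") auto
    qed
    also have "\<dots> = (1 - pmf Q w0) * D"
      by (subst Bochner_Integration.integral_diff[OF measure_pmf.integrable_const point_mass])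
        (simp add: measure_pmf_single algebra_simps)
    finally show ?thesis .
  qed
  have "D \<le> (1 - pmf Q w0) * D"
    unfolding D_def by (rule cSUP_least) (use contraction in \<open>auto simp: D_def\<close>)
  then have "pmf Q w0 * D \<le> 0"
    by (simp add: algebra_simps)
  moreover have "pmf Q w0 > 0"
    using w0 by (simp add: pmf_positive)
  ultimately have "D \<le> 0"
    by (simp add: mult_le_0_iff)
  then show ?thesis
    using d_le_D[of S] by (simp add: d_def)
qed

lemma stationary_unique_of_synchronizing_map:
  fixes Q :: "'w pmf" and F :: "'w \<Rightarrow> 's \<Rightarrow> 's"
  assumes "bind_pmf Q (\<lambda>w. map_pmf (F w) \<mu>) = \<mu>" "bind_pmf Q (\<lambda>w. map_pmf (F w) \<nu>) = \<nu>"
    and "w0 \<in> set_pmf Q"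
    and "\<And>x. x \<in> set_pmf \<mu> \<union> set_pmf \<nu> \<Longrightarrow> F w0 x = c"
  shows "\<mu> = \<nu>"
proof (rule pmf_eqI)
  fix x
  have "measure_pmf.prob \<mu> {x} \<le> measure_pmf.prob \<nu> {x}"
    by (rule stationary_le_of_synchronizing_map[OF assms])
  moreover have "measure_pmf.prob \<nu> {x} \<le> measure_pmf.prob \<mu> {x}"
    by (rule stationary_le_of_synchronizing_map[OF assms(2,1,3)]) (use assms(4) in auto)
  ultimately show "pmf \<mu> x = pmf \<nu> x"
    by (simp add: measure_pmf_single)
qed

lemma stationary_iterate:
  assumes "bind_pmf q (\<lambda>e. map_pmf (f e) \<mu>) = \<mu>"
  shows "bind_pmf (replicate_pmf k q) (\<lambda>w. map_pmf (fold f w) \<mu>) = \<mu>"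
proof (induction k)
  case 0
  then show ?case by (simp add: bind_return_pmf map_pmf_def bind_return_pmf')
next
  case (Suc k)
  have "bind_pmf (replicate_pmf (Suc k) q) (\<lambda>w. map_pmf (fold f w) \<mu>)
      = bind_pmf q (\<lambda>e. bind_pmf (replicate_pmf k q) (\<lambda>w. map_pmf (fold f w) (map_pmf (f e) \<mu>)))"
    by (simp add: bind_assoc_pmf bind_return_pmf pmf.map_comp)
  also have "\<dots> = bind_pmf (replicate_pmf k q) (\<lambda>w. bind_pmf q (\<lambda>e. map_pmf (fold f w) (map_pmf (f e) \<mu>)))"
    by (rule bind_commute_pmf)
  also have "\<dots> = bind_pmf (replicate_pmf k q) (\<lambda>w. map_pmf (fold f w) (bind_pmf q (\<lambda>e. map_pmf (f e) \<mu>)))"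
    by (simp add: map_bind_pmf)
  finally show ?case
    using Suc by (simp add: assms)
qed

section \<open>Uniqueness of the stationary distribution of the Moran chain\<close>

text \<open>
  One transition of the chain as a deterministic map, so that the same randomness can drive two
  copies of the chain.
\<close>

definition reattach :: "nat \<times> nat \<Rightarrow> digraph \<Rightarrow> digraph" where
  "reattach = (\<lambda>(u, v) G. insert (u, v) (disconnect v G))"

lemma moran_step_eq_reattach:
  "moran_step n G = map_pmf (\<lambda>e. reattach e G) (pmf_of_set (vertex_pairs n))"
  by (simp add: moran_step_def reattach_def case_prod_unfold)

lemma finite_vertex_pairs [simp]: "finite (vertex_pairs n)"
  by (rule finite_subset[of _ "{1..n} \<times> {1..n}"]) (auto simp: vertex_pairs_def)

lemma vertex_pairs_nonempty:
  assumes "n \<ge> 2"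
  shows "vertex_pairs n \<noteq> {}"
proof -
  have "(1, 2) \<in> vertex_pairs n"
    using assms by (simp add: vertex_pairs_def)
  then show ?thesis by blast
qed

lemma bind_moran_step:
  "bind_pmf \<mu> (moran_step n) = bind_pmf (pmf_of_set (vertex_pairs n)) (\<lambda>e. map_pmf (reattach e) \<mu>)"
  unfolding moran_step_eq_reattach map_pmf_def by (rule bind_commute_pmf)

lemma fold_reattach_in_digraphs_on:
  "set w \<subseteq> vertex_pairs n \<Longrightarrow> G \<in> digraphs_on n \<Longrightarrow> fold reattach w G \<in> digraphs_on n"
proof (induction w arbitrary: G)
  case (Cons e w)
  have "reattach e G \<in> digraphs_on n"
    using Cons.prems by (cases e) (auto simp: reattach_def digraphs_on_def disconnect_def)
  then show ?case using Cons by simp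
qed simp

text \<open>
  Reattaching \<open>v\<close> overwrites everything at \<open>v\<close> and never spoils an agreement at another vertex:
  the only new edge is the same in both graphs. So the set \<open>R\<close> of vertices at which two graphs are
  known to agree grows by every reattached vertex.
\<close>

lemma fold_reattach_forgets:
  assumes "\<And>a b. a \<in> R \<or> b \<in> R \<Longrightarrow> (a, b) \<in> G \<longleftrightarrow> (a, b) \<in> H"
    and "a \<in> R \<union> snd ` set w \<or> b \<in> R \<union> snd ` set w"
  shows "(a, b) \<in> fold reattach w G \<longleftrightarrow> (a, b) \<in> fold reattach w H"
  using assms
proof (induction w arbitrary: G H R)
  case (Cons e w)
  obtain u v where e: "e = (u, v)" by (cases e)
  have "(a, b) \<in> fold reattach w (reattach e G) \<longleftrightarrow> (a, b) \<in> fold reattach w (reattach e H)"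
  proof (rule Cons.IH[of "insert v R"])
    show "(a, b) \<in> reattach e G \<longleftrightarrow> (a, b) \<in> reattach e H" if "a \<in> insert v R \<or> b \<in> insert v R" for a b
      using that Cons.prems(1)[of a b] by (auto simp: reattach_def disconnect_def e)
    show "a \<in> insert v R \<union> snd ` set w \<or> b \<in> insert v R \<union> snd ` set w"
      using Cons.prems(2) by (auto simp: e)
  qed
  then show ?case by simp
qed auto

text \<open>
  A word in which every vertex is reattached once has positive probability and sends all digraphs
  to the same one.
\<close>

lemma moran_stationary_unique:
  assumes n: "n \<ge> 2" and st: "moran_stationary n \<mu>" "moran_stationary n \<nu>"
  shows "\<mu> = \<nu>"
proof -
  define w0 :: "(nat \<times> nat) list"
    where "w0 = map (\<lambda>v. (if v = 1 then 2 else 1, v)) [1..<Suc n]"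
  have word: "set w0 \<subseteq> vertex_pairs n" and all_vertices: "snd ` set w0 = {1..n}" and "length w0 = n"
    using n by (auto simp: w0_def vertex_pairs_def image_image split: if_splits)
  have merge: "fold reattach w0 G = fold reattach w0 {}" if "G \<in> digraphs_on n" for G
  proof -
    have "fold reattach w0 G \<subseteq> vertex_pairs n" "fold reattach w0 {} \<subseteq> vertex_pairs n"
      using fold_reattach_in_digraphs_on[OF word] that by (auto simp: digraphs_on_def)
    moreover have "(a, b) \<in> fold reattach w0 G \<longleftrightarrow> (a, b) \<in> fold reattach w0 {}"
      if "(a, b) \<in> vertex_pairs n" for a b
      by (rule fold_reattach_forgets[of "{}"])
        (use that all_vertices in \<open>auto simp: vertex_pairs_def\<close>)
    ultimately show ?thesis by (auto 0 3)
  qed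
  show ?thesis
  proof (rule stationary_unique_of_synchronizing_map)
    let ?Q = "replicate_pmf n (pmf_of_set (vertex_pairs n))"
    show "bind_pmf ?Q (\<lambda>w. map_pmf (fold reattach w) \<mu>) = \<mu>"
      "bind_pmf ?Q (\<lambda>w. map_pmf (fold reattach w) \<nu>) = \<nu>"
      using st by (auto intro!: stationary_iterate simp: moran_stationary_def bind_moran_step)
    show "w0 \<in> set_pmf ?Q"
      using word \<open>length w0 = n\<close> n by (auto simp: set_replicate_pmf vertex_pairs_nonempty)
    show "fold reattach w0 G = fold reattach w0 {}" if "G \<in> set_pmf \<mu> \<union> set_pmf \<nu>" for G
      by (rule merge) (use that st in \<open>auto simp: moran_stationary_def\<close>)
  qed
qed

section \<open>The stationary lift: a ranking of the vertices and a mother for each vertex\<close>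

text \<open>
  Each vertex \<open>v\<close> has a mother \<open>m v\<close> and a rank \<open>r v\<close>, to be thought of as the order of the last
  reattachment times. The edge to \<open>v\<close> has survived iff the mother has not been reattached since.
\<close>

definition ranked_forest :: "nat \<Rightarrow> (nat \<Rightarrow> nat) \<Rightarrow> (nat \<Rightarrow> nat) \<Rightarrow> digraph" where
  "ranked_forest n r m = {(m v, v) | v. v \<in> {1..n} \<and> m v \<in> {1..n} \<and> r (m v) < r v}"

text \<open>
  The value outside \<open>{1..n}\<close> is \<open>0\<close>, a fixed point of all permutations of \<open>{1..n}\<close>; conjugation by
  such a permutation then maps the support to itself.
\<close>

definition uniform_mothers :: "nat \<Rightarrow> (nat \<Rightarrow> nat) pmf" where
  "uniform_mothers n = Pi_pmf {1..n} 0 (\<lambda>v. pmf_of_set ({1..n} - {v}))"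

definition uniform_ranking :: "nat \<Rightarrow> (nat \<Rightarrow> nat) pmf" where
  "uniform_ranking n = pmf_of_set {p. p permutes {1..n}}"

definition ranked_forest_law :: "nat \<Rightarrow> digraph pmf" where
  "ranked_forest_law n =
     do {r \<leftarrow> uniform_ranking n; m \<leftarrow> uniform_mothers n; return_pmf (ranked_forest n r m)}"

text \<open>
  The cycle that moves rank \<open>i\<close> to the top and keeps the relative order of the other ranks.
\<close>

definition promote :: "nat \<Rightarrow> nat \<Rightarrow> nat \<Rightarrow> nat" where
  "promote n i j = (if j = i then n else if i < j \<and> j \<le> n then j - 1 else j)"

lemma finite_perms [simp]: "finite {p. p permutes {1..n::nat}}"
  by (simp add: finite_permutations)

lemma perms_nonempty [simp]: "{p. p permutes {1..n::nat}} \<noteq> {}"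
  using permutes_id by blast

lemma set_uniform_ranking [simp]: "set_pmf (uniform_ranking n) = {p. p permutes {1..n}}"
  by (simp only: uniform_ranking_def set_pmf_of_set perms_nonempty finite_perms not_False_eq_True)

lemma other_vertices_nonempty:
  assumes "n \<ge> (2::nat)"
  shows "{1..n} - {v} \<noteq> {}"
proof -
  have "1 \<in> {1..n} - {v} \<or> 2 \<in> {1..n} - {v}" using assms by auto
  then show ?thesis by blast
qed

lemma promote_permutes:
  assumes "i \<in> {1..n}"
  shows "promote n i permutes {1..n}"
proof (rule bij_imp_permutes)
  show "bij_betw (promote n i) {1..n} {1..n}"
    by (rule bij_betw_byWitness[where f' = "\<lambda>j. if j = n then i else if i \<le> j then j + 1 else j"])
      (use assms in \<open>auto simp: promote_def split: if_splits\<close>)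
  show "promote n i j = j" if "j \<notin> {1..n}" for j
    using that assms by (auto simp: promote_def)
qed

text \<open>
  The vertex \<open>v\<close> now outranks all others. So it is not a mother of smaller rank for any vertex, which
  is the removal of its outgoing edges, while its own new mother does have a smaller rank, which is
  the new edge. Between the other vertices nothing changes, as their relative order is kept.
\<close>

lemma reattach_ranked_forest:
  assumes r: "r permutes {1..n}" and uv: "(u, v) \<in> vertex_pairs n"
  shows "reattach (u, v) (ranked_forest n r m)
       = ranked_forest n (promote n (r v) \<circ> r) (m(v := u))"
proof -
  let ?r' = "promote n (r v) \<circ> r"
  have range: "r w \<in> {1..n}" if "w \<in> {1..n}" for w
    using permutes_in_image[OF r, of w] that by blast
  have inj: "r w = r x \<longleftrightarrow> w = x" for w x
    using permutes_inj[OF r] by (auto dest: injD)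
  have u: "u \<in> {1..n}" and v: "v \<in> {1..n}" and "u \<noteq> v"
    using uv by (auto simp: vertex_pairs_def)
  have top: "?r' v = n"
    by (simp add: promote_def)
  have below: "?r' w < n" if "w \<in> {1..n}" "w \<noteq> v" for w
    using range[OF that(1)] range[OF v] inj[of w v] that(2) by (auto simp: promote_def)
  have same_order: "?r' w < ?r' x \<longleftrightarrow> r w < r x"
    if "w \<in> {1..n}" "w \<noteq> v" "x \<in> {1..n}" "x \<noteq> v" for w x
    using range[OF that(1)] range[OF that(3)] inj[of w v] inj[of x v] that
    by (auto simp: promote_def)
  have "(a, b) \<in> reattach (u, v) (ranked_forest n r m)
      \<longleftrightarrow> (a, b) \<in> ranked_forest n ?r' (m(v := u))" for a b
  proof (cases "b = v")
    case True
    then show ?thesis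
      using u v \<open>u \<noteq> v\<close> top below[of u]
      by (auto simp: reattach_def disconnect_def ranked_forest_def)
  next
    case False
    have "(a, b) \<in> reattach (u, v) (ranked_forest n r m)
        \<longleftrightarrow> a \<noteq> v \<and> a = m b \<and> b \<in> {1..n} \<and> m b \<in> {1..n} \<and> r (m b) < r b"
      using False by (auto simp: reattach_def disconnect_def ranked_forest_def)
    also have "\<dots> \<longleftrightarrow> a = m b \<and> b \<in> {1..n} \<and> m b \<in> {1..n} \<and> ?r' (m b) < ?r' b"
    proof (cases "a = v")
      case True
      then show ?thesis using top below[of b] False by auto
    next
      case a: False
      then show ?thesis using same_order[of "m b" b] False by blast
    qed
    also have "\<dots> \<longleftrightarrow> (a, b) \<in> ranked_forest n ?r' (m(v := u))"
      using False by (auto simp: ranked_forest_def)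
    finally show ?thesis .
  qed
  then show ?thesis by auto
qed

lemma ranked_forest_in_digraphs_on: "ranked_forest n r m \<in> digraphs_on n"
  by (auto simp: ranked_forest_def digraphs_on_def vertex_pairs_def)

lemma pmf_of_set_vertex_pairs:
  assumes "n \<ge> 2"
  shows "pmf_of_set (vertex_pairs n)
       = do {v \<leftarrow> pmf_of_set {1..n}; u \<leftarrow> pmf_of_set ({1..n} - {v}); return_pmf (u, v)}"
proof -
  define row where "row v = (\<lambda>u. (u, v)) ` ({1..n} - {v})" for v
  have union: "vertex_pairs n = (\<Union>v\<in>{1..n}. row v)"
    by (auto simp: vertex_pairs_def row_def)
  have "pmf_of_set (\<Union>v\<in>{1..n}. row v) = do {v \<leftarrow> pmf_of_set {1..n}; pmf_of_set (row v)}"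
  proof (rule pmf_of_set_UN)
    show "finite (\<Union>v\<in>{1..n}. row v)"
      using finite_vertex_pairs[of n] by (simp only: union)
    show "{1..n} \<noteq> {}" using assms by auto
    show "row v \<noteq> {}" for v
      using other_vertices_nonempty[OF assms] by (simp add: row_def)
    show "card (row v) = n - 1" if "v \<in> {1..n}" for v
      using that by (simp add: row_def card_image inj_on_def)
    show "disjoint_family_on row {1..n}"
      by (auto simp: disjoint_family_on_def row_def)
  qed
  also have "\<dots> = do {v \<leftarrow> pmf_of_set {1..n}; u \<leftarrow> pmf_of_set ({1..n} - {v}); return_pmf (u, v)}"
  proof (rule bind_pmf_cong[OF refl])
    fix v
    show "pmf_of_set (row v) = do {u \<leftarrow> pmf_of_set ({1..n} - {v}); return_pmf (u, v)}"
      unfolding row_def map_pmf_def[symmetric]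
      by (rule map_pmf_of_set_inj[symmetric])
        (use other_vertices_nonempty[OF assms] in \<open>auto simp: inj_on_def\<close>)
  qed
  finally show ?thesis by (simp only: union)
qed

text \<open>
  The drawn value at \<open>v\<close> is overwritten by an independent one of the same law.
\<close>

lemma refresh_uniform_mothers:
  assumes "v \<in> {1..n}"
  shows "do {m \<leftarrow> uniform_mothers n; u \<leftarrow> pmf_of_set ({1..n} - {v}); return_pmf (m(v := u))}
       = uniform_mothers n"
proof -
  define B where "B = {1..n} - {v}"
  define q where "q = (\<lambda>v. pmf_of_set ({1..n} - {v}))"
  have "Pi_pmf (insert v B) 0 q = do {y \<leftarrow> q v; f \<leftarrow> Pi_pmf B 0 q; return_pmf (f(v := y))}"
    by (rule Pi_pmf_insert') (auto simp: B_def)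
  also have "insert v B = {1..n}"
    using assms by (auto simp: B_def)
  finally have split:
    "uniform_mothers n = do {y \<leftarrow> q v; f \<leftarrow> Pi_pmf B 0 q; return_pmf (f(v := y))}"
    unfolding uniform_mothers_def q_def[symmetric] .
  have "do {m \<leftarrow> uniform_mothers n; u \<leftarrow> q v; return_pmf (m(v := u))}
      = do {f \<leftarrow> Pi_pmf B 0 q; u \<leftarrow> q v; return_pmf (f(v := u))}"
    by (simp add: split bind_assoc_pmf bind_return_pmf)
  also have "\<dots> = uniform_mothers n"
    unfolding split by (rule bind_commute_pmf)
  finally show ?thesis by (simp add: q_def)
qed

text \<open>
  Writing the promoted vertex as \<open>v = inv r i\<close> makes its rank \<open>i\<close> uniform; for a fixed rank, the
  map \<open>r \<mapsto> promote n i \<circ> r\<close> is a left translation of the symmetric group.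
\<close>

lemma promote_uniform_ranking:
  assumes "n \<ge> 1"
  shows "do {r \<leftarrow> uniform_ranking n; v \<leftarrow> pmf_of_set {1..n}; return_pmf (promote n (r v) \<circ> r)}
       = uniform_ranking n"
proof -
  have "do {r \<leftarrow> uniform_ranking n; v \<leftarrow> pmf_of_set {1..n}; return_pmf (promote n (r v) \<circ> r)}
      = do {r \<leftarrow> uniform_ranking n; i \<leftarrow> pmf_of_set {1..n}; return_pmf (promote n i \<circ> r)}"
  proof (rule bind_pmf_cong[OF refl])
    fix r assume "r \<in> set_pmf (uniform_ranking n)"
    then have "map_pmf r (pmf_of_set {1..n}) = pmf_of_set {1..n}"
      using assms by (intro map_pmf_of_set_bij_betw permutes_imp_bij) auto
    then have "do {i \<leftarrow> map_pmf r (pmf_of_set {1..n}); return_pmf (promote n i \<circ> r)}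
        = do {i \<leftarrow> pmf_of_set {1..n}; return_pmf (promote n i \<circ> r)}"
      by simp
    then show "do {v \<leftarrow> pmf_of_set {1..n}; return_pmf (promote n (r v) \<circ> r)}
        = do {i \<leftarrow> pmf_of_set {1..n}; return_pmf (promote n i \<circ> r)}"
      by (simp add: bind_map_pmf)
  qed
  also have "\<dots> = do {i \<leftarrow> pmf_of_set {1..n}; map_pmf (\<lambda>r. promote n i \<circ> r) (uniform_ranking n)}"
    unfolding map_pmf_def by (rule bind_commute_pmf)
  also have "\<dots> = do {i \<leftarrow> pmf_of_set {1..n}; uniform_ranking n}"
  proof (rule bind_pmf_cong[OF refl])
    fix i assume "i \<in> set_pmf (pmf_of_set {1..n})"
    then have p: "promote n i permutes {1..n}"
      using assms by (intro promote_permutes) simp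
    have "bij_betw (\<lambda>r. promote n i \<circ> r) {p. p permutes {1..n}} {p. p permutes {1..n}}"
      by (rule bij_betw_byWitness[where f' = "\<lambda>r. inv (promote n i) \<circ> r"])
        (use p in \<open>auto simp: comp_assoc[symmetric] permutes_inv_o[OF p]
           intro: permutes_compose permutes_inv simp del: One_nat_def\<close>)
    then show "map_pmf (\<lambda>r. promote n i \<circ> r) (uniform_ranking n) = uniform_ranking n"
      unfolding uniform_ranking_def by (rule map_pmf_of_set_bij_betw) (rule perms_nonempty finite_perms)+
  qed
  finally show ?thesis by simp
qed

text \<open>
  Given the ranking and the reattached vertex \<open>v\<close>, the refreshed mothers still have the law
  \<open>uniform_mothers\<close>, which depends on neither. They are therefore independent of the promoted
  ranking, and the two invariances can be applied one after the other.
\<close>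

lemma moran_stationary_ranked_forest_law:
  assumes n: "n \<ge> 2"
  shows "moran_stationary n (ranked_forest_law n)"
proof -
  let ?R = "uniform_ranking n" and ?A = "uniform_mothers n" and ?V = "pmf_of_set {1..n}"
  let ?U = "\<lambda>v. pmf_of_set ({1..n} - {v})"
  have "bind_pmf (ranked_forest_law n) (moran_step n)
      = do {r \<leftarrow> ?R; m \<leftarrow> ?A; v \<leftarrow> ?V; u \<leftarrow> ?U v;
            return_pmf (reattach (u, v) (ranked_forest n r m))}"
    by (simp add: ranked_forest_law_def moran_step_eq_reattach map_pmf_def bind_assoc_pmf
        bind_return_pmf pmf_of_set_vertex_pairs[OF n])
  also have "\<dots> = do {r \<leftarrow> ?R; m \<leftarrow> ?A; v \<leftarrow> ?V; u \<leftarrow> ?U v;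
            return_pmf (ranked_forest n (promote n (r v) \<circ> r) (m(v := u)))}"
    using n other_vertices_nonempty[OF n]
    by (intro bind_pmf_cong refl arg_cong[where f = return_pmf] reattach_ranked_forest)
      (auto simp: vertex_pairs_def)
  also have "\<dots> = do {r \<leftarrow> ?R; v \<leftarrow> ?V; m \<leftarrow> ?A; u \<leftarrow> ?U v;
            return_pmf (ranked_forest n (promote n (r v) \<circ> r) (m(v := u)))}"
    by (intro bind_pmf_cong refl bind_commute_pmf)
  also have "\<dots> = do {r \<leftarrow> ?R; v \<leftarrow> ?V;
            m \<leftarrow> do {m \<leftarrow> ?A; u \<leftarrow> ?U v; return_pmf (m(v := u))};
            return_pmf (ranked_forest n (promote n (r v) \<circ> r) m)}"
    by (simp add: bind_assoc_pmf bind_return_pmf)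
  also have "\<dots> = do {r \<leftarrow> ?R; v \<leftarrow> ?V; m \<leftarrow> ?A;
            return_pmf (ranked_forest n (promote n (r v) \<circ> r) m)}"
    using n by (intro bind_pmf_cong refl refresh_uniform_mothers) auto
  also have "\<dots> = do {r \<leftarrow> do {r \<leftarrow> ?R; v \<leftarrow> ?V; return_pmf (promote n (r v) \<circ> r)}; m \<leftarrow> ?A;
            return_pmf (ranked_forest n r m)}"
    by (simp add: bind_assoc_pmf bind_return_pmf)
  also have "\<dots> = ranked_forest_law n"
    using n by (simp only: promote_uniform_ranking ranked_forest_law_def)
  finally have "bind_pmf (ranked_forest_law n) (moran_step n) = ranked_forest_law n" .
  moreover have "set_pmf (ranked_forest_law n) \<subseteq> digraphs_on n"
    by (auto simp: ranked_forest_law_def ranked_forest_in_digraphs_on)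
  ultimately show ?thesis
    by (simp add: moran_stationary_def)
qed

lemma moran_forest_eq_ranked_forest_law:
  assumes "n \<ge> 2"
  shows "moran_forest n = ranked_forest_law n"
  unfolding moran_forest_def
  using moran_stationary_ranked_forest_law[OF assms] moran_stationary_unique[OF assms]
  by (intro the_equality)

section \<open>Relabeling the attachment forest\<close>

text \<open>
  In the attachment forest a label is a rank. After relabeling, the vertex \<open>v\<close> has rank \<open>inv p v\<close>, and
  the vertex that its rank attaches to is now called \<open>p (u (inv p v))\<close>.
\<close>

lemma relabel_attachment_forest:
  assumes p: "p permutes {1..n}"
  shows "relabel p (attachment_forest n u) = ranked_forest n (inv p) (p \<circ> u \<circ> inv p)"
proof -
  have inv_p [simp]: "inv p (p x) = x" "p (inv p x) = x" for x
    using permutes_inverses[OF p] by auto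
  have range: "p x \<in> {1..n} \<longleftrightarrow> x \<in> {1..n}" for x
    using permutes_in_image[OF p] by blast
  have "(a, b) \<in> relabel p (attachment_forest n u)
      \<longleftrightarrow> (inv p a, inv p b) \<in> attachment_forest n u" for a b
  proof
    assume "(inv p a, inv p b) \<in> attachment_forest n u"
    then have "map_prod p p (inv p a, inv p b) \<in> relabel p (attachment_forest n u)"
      unfolding relabel_def by (rule imageI)
    then show "(a, b) \<in> relabel p (attachment_forest n u)" by simp
  qed (auto simp: relabel_def)
  moreover have "(inv p a, inv p b) \<in> attachment_forest n u
      \<longleftrightarrow> (a, b) \<in> ranked_forest n (inv p) (p \<circ> u \<circ> inv p)" for a b
    using range[of "inv p a"] range[of "inv p b"] range[of "u (inv p b)"]
    by (auto simp: attachment_forest_def ranked_forest_def simp del: atLeastAtMost_iff)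
  ultimately show ?thesis by auto
qed

lemma conjugate_uniform_mothers:
  assumes n: "n \<ge> 2" and p: "p permutes {1..n}"
  shows "map_pmf (\<lambda>m. p \<circ> m \<circ> inv p) (uniform_mothers n) = uniform_mothers n"
proof -
  let ?A = "PiE_dflt {1..n} (0::nat) (\<lambda>v. {1..n} - {v})"
  have uniform: "uniform_mothers n = pmf_of_set ?A"
    unfolding uniform_mothers_def
    by (rule Pi_pmf_of_set) (use other_vertices_nonempty[OF n] in auto)
  have conjugate: "p \<circ> m \<circ> inv p \<in> ?A" if m: "m \<in> ?A" and p: "p permutes {1..n}" for m p
  proof -
    have range: "p x \<in> {1..n} \<longleftrightarrow> x \<in> {1..n}" "inv p x \<in> {1..n} \<longleftrightarrow> x \<in> {1..n}" for x
      using permutes_in_image[OF p] permutes_in_image[OF permutes_inv[OF p]] by blast+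
    have "p (m (inv p x)) \<in> {1..n} - {x}" if "x \<in> {1..n}" for x
    proof -
      have "m (inv p x) \<in> {1..n} - {inv p x}"
        using m that range(2)[of x] unfolding PiE_dflt_def by blast
      then show ?thesis
        using range(1) permutes_inv_eq[OF p] by (metis DiffD1 DiffD2 DiffI singletonD singletonI)
    qed
    moreover have "p (m (inv p x)) = 0" if "x \<notin> {1..n}" for x
    proof -
      have "m (inv p x) = 0"
        using m that range(2)[of x] unfolding PiE_dflt_def by blast
      then show ?thesis
        using permutes_not_in[OF p, of 0] by simp
    qed
    ultimately show ?thesis by (auto simp: PiE_dflt_def)
  qed
  have "bij_betw (\<lambda>m. p \<circ> m \<circ> inv p) ?A ?A"
  proof (rule bij_betw_byWitness[where f' = "\<lambda>m. inv p \<circ> m \<circ> p"])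
    show "\<forall>m\<in>?A. inv p \<circ> (p \<circ> m \<circ> inv p) \<circ> p = m" "\<forall>m\<in>?A. p \<circ> (inv p \<circ> m \<circ> p) \<circ> inv p = m"
      by (auto simp: fun_eq_iff permutes_inverses[OF p])
    show "(\<lambda>m. p \<circ> m \<circ> inv p) ` ?A \<subseteq> ?A"
      using conjugate[OF _ p] by blast
    show "(\<lambda>m. inv p \<circ> m \<circ> p) ` ?A \<subseteq> ?A"
      using conjugate[OF _ permutes_inv[OF p]] permutes_inv_inv[OF p] by auto
  qed
  then show ?thesis
    unfolding uniform
    by (rule map_pmf_of_set_bij_betw)
      (use other_vertices_nonempty[OF n] in \<open>auto intro!: finite_PiE_dflt\<close>)
qed

lemma inv_uniform_ranking: "map_pmf inv (uniform_ranking n) = uniform_ranking n"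
proof -
  have "bij_betw inv {p. p permutes {1..n}} {p. p permutes {1..n}}"
    by (rule bij_betw_byWitness[where f' = inv]) (auto simp: permutes_inv_inv permutes_inv)
  then show ?thesis
    unfolding uniform_ranking_def by (rule map_pmf_of_set_bij_betw) (rule perms_nonempty finite_perms)+
qed

lemma relabel_attachment_law:
  assumes n: "n \<ge> 2"
  shows "bind_pmf (map_pmf (attachment_forest n) (uniform_mothers n))
           (\<lambda>G. map_pmf (\<lambda>p. relabel p G) (uniform_ranking n)) = ranked_forest_law n"
proof -
  let ?R = "uniform_ranking n" and ?A = "uniform_mothers n"
  have "bind_pmf (map_pmf (attachment_forest n) ?A) (\<lambda>G. map_pmf (\<lambda>p. relabel p G) ?R)
      = do {p \<leftarrow> ?R; u \<leftarrow> ?A; return_pmf (relabel p (attachment_forest n u))}"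
    unfolding bind_map_pmf map_pmf_def[of "\<lambda>p. relabel p _"] by (rule bind_commute_pmf)
  also have "\<dots> = do {p \<leftarrow> ?R; u \<leftarrow> ?A; return_pmf (ranked_forest n (inv p) (p \<circ> u \<circ> inv p))}"
    by (intro bind_pmf_cong refl) (simp add: relabel_attachment_forest)
  also have "\<dots> = do {p \<leftarrow> ?R; m \<leftarrow> map_pmf (\<lambda>u. p \<circ> u \<circ> inv p) ?A;
                   return_pmf (ranked_forest n (inv p) m)}"
    by (simp add: bind_map_pmf)
  also have "\<dots> = do {p \<leftarrow> ?R; m \<leftarrow> ?A; return_pmf (ranked_forest n (inv p) m)}"
    by (intro bind_pmf_cong refl conjugate_uniform_mothers n) simp
  also have "\<dots> = do {r \<leftarrow> map_pmf inv ?R; m \<leftarrow> ?A; return_pmf (ranked_forest n r m)}"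
    by (simp add: bind_map_pmf)
  finally show ?thesis
    by (simp add: inv_uniform_ranking ranked_forest_law_def)
qed

section \<open>From random variables to laws\<close>

text \<open>
  \<open>Y\<close> may take uncountably many values on a null set, where joint measurability for the discrete
  sigma-algebra is not automatic. The finite range \<open>C\<close> of \<open>X\<close> provides it, by splitting each
  preimage into finitely many events \<open>X = x\<close>, \<open>f x Y \<in> S\<close>.
\<close>

lemma (in prob_space) distr_of_independent_pair:
  assumes indep: "indep_rvs (count_space UNIV) X (count_space UNIV) Y"
    and X: "distr M (count_space UNIV) X = measure_pmf a"
    and Y: "distr M (count_space UNIV) Y = measure_pmf b"
    and C: "finite C" "\<And>\<omega>. \<omega> \<in> space M \<Longrightarrow> X \<omega> \<in> C"
  shows "distr M (count_space UNIV) (\<lambda>\<omega>. f (X \<omega>) (Y \<omega>))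
       = measure_pmf (bind_pmf a (\<lambda>x. map_pmf (f x) b))"
proof (rule measure_eqI)
  have rv [measurable]: "X \<in> measurable M (count_space UNIV)" "Y \<in> measurable M (count_space UNIV)"
    and ind: "indep_set (sets (vimage_algebra (space M) X (count_space UNIV)))
                        (sets (vimage_algebra (space M) Y (count_space UNIV)))"
    using indep by (auto simp: indep_rvs_def)
  let ?E = "\<lambda>S x. (X -` {x} \<inter> space M) \<inter> (Y -` (f x -` S) \<inter> space M)"
  have decomp: "(\<lambda>\<omega>. f (X \<omega>) (Y \<omega>)) -` S \<inter> space M = (\<Union>x\<in>C. ?E S x)" for S
    using C by auto
  have E [measurable]: "?E S x \<in> events" for S x
    by (intro sets.Int measurable_sets[OF rv(1)] measurable_sets[OF rv(2)]) auto
  have Z: "(\<lambda>\<omega>. f (X \<omega>) (Y \<omega>)) \<in> measurable M (count_space UNIV)"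
    unfolding measurable_def by (auto simp: decomp intro!: sets.finite_UN C E)
  have prob_X: "prob (X -` S \<inter> space M) = measure_pmf.prob a S" for S
    using arg_cong[OF X, of "\<lambda>N. measure N S"] by (simp add: measure_distr)
  have prob_Y: "prob (Y -` S \<inter> space M) = measure_pmf.prob b S" for S
    using arg_cong[OF Y, of "\<lambda>N. measure N S"] by (simp add: measure_distr)
  have "X -` C \<inter> space M = space M"
    using C by auto
  then have "measure_pmf.prob a C = 1"
    using prob_X[of C] by (simp add: prob_space)
  then have supp: "set_pmf a \<subseteq> C"
    by (simp add: measure_pmf.prob_eq_1 AE_measure_pmf_iff subset_eq)
  show "emeasure (distr M (count_space UNIV) (\<lambda>\<omega>. f (X \<omega>) (Y \<omega>))) S
      = emeasure (measure_pmf (bind_pmf a (\<lambda>x. map_pmf (f x) b))) S" for S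
  proof -
    have prob_E: "prob (?E S x) = pmf a x * measure_pmf.prob b (f x -` S)" for x
      by (subst indep_setD[OF ind])
        (auto simp: prob_X prob_Y measure_pmf_single intro!: in_vimage_algebra)
    have "emeasure (distr M (count_space UNIV) (\<lambda>\<omega>. f (X \<omega>) (Y \<omega>))) S = emeasure M (\<Union>x\<in>C. ?E S x)"
      by (simp add: emeasure_distr Z decomp)
    also have "\<dots> = (\<Sum>x\<in>C. emeasure M (?E S x))"
      by (rule sum_emeasure[symmetric]) (use C E in \<open>auto simp: disjoint_family_on_def\<close>)
    also have "\<dots> = (\<Sum>x\<in>C. emeasure b (f x -` S) * ennreal (pmf a x))"
      by (simp add: emeasure_eq_measure prob_E measure_pmf.emeasure_eq_measure
          ennreal_mult'[symmetric] mult.commute)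
    also have "\<dots> = (\<integral>\<^sup>+x. emeasure b (f x -` S) \<partial>measure_pmf a)"
      by (rule nn_integral_measure_pmf_support[symmetric]) (use C supp in auto)
    finally show ?thesis by simp
  qed
qed simp

text \<open>
  The families \<open>U\<close> under \<open>M\<close> and the coordinates under \<open>Pi_pmf\<close> are both independent with the same
  marginals, so they induce the same product measure on \<open>I\<close>; and \<open>g\<close> only looks at \<open>I\<close>.
\<close>

lemma (in prob_space) distr_independent_eq_Pi_pmf:
  fixes U :: "'i \<Rightarrow> 'a \<Rightarrow> 'b"
  assumes I: "finite I" "I \<noteq> {}"
    and indep: "indep_vars (\<lambda>_. count_space UNIV) U I"
    and U: "\<And>i. i \<in> I \<Longrightarrow> distr M (count_space UNIV) (U i) = measure_pmf (q i)"
    and g [measurable]: "g \<in> measurable (\<Pi>\<^sub>M i\<in>I. count_space UNIV) (count_space UNIV)"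
    and g_restrict: "\<And>u. g (restrict u I) = g u"
  shows "distr M (count_space UNIV) (\<lambda>\<omega>. g (\<lambda>i. U i \<omega>)) = measure_pmf (map_pmf g (Pi_pmf I d q))"
proof -
  let ?P = "\<Pi>\<^sub>M i\<in>I. count_space (UNIV :: 'b set)" and ?N = "measure_pmf (Pi_pmf I d q)"
  have rv [measurable]: "i \<in> I \<Longrightarrow> U i \<in> measurable M (count_space UNIV)" for i
    using indep by (auto simp: indep_vars_def)
  have "distr M ?P (\<lambda>\<omega>. \<lambda>i\<in>I. U i \<omega>) = (\<Pi>\<^sub>M i\<in>I. measure_pmf (q i))"
    using indep U by (subst (asm) indep_vars_iff_distr_eq_PiM'[OF I(2) rv]) (auto intro!: PiM_cong)
  also have "\<dots> = (\<Pi>\<^sub>M i\<in>I. distr ?N (count_space UNIV) (\<lambda>f. f i))"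
  proof (rule PiM_cong[OF refl])
    fix i assume "i \<in> I"
    then have "map_pmf (\<lambda>f. f i) (Pi_pmf I d q) = q i"
      using I by (simp add: Pi_pmf_component)
    then show "measure_pmf (q i) = distr ?N (count_space UNIV) (\<lambda>f. f i)"
      by (metis map_pmf_rep_eq)
  qed
  also have "\<dots> = distr ?N ?P (\<lambda>f. \<lambda>i\<in>I. f i)"
    using indep_vars_Pi_pmf[OF I(1), of d q]
    by (subst (asm) prob_space.indep_vars_iff_distr_eq_PiM'[OF measure_pmf.prob_space_axioms I(2)]) auto
  finally have law: "distr M ?P (\<lambda>\<omega>. \<lambda>i\<in>I. U i \<omega>) = distr ?N ?P (\<lambda>f. \<lambda>i\<in>I. f i)" .
  have "distr M (count_space UNIV) (\<lambda>\<omega>. g (\<lambda>i. U i \<omega>))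
      = distr (distr M ?P (\<lambda>\<omega>. \<lambda>i\<in>I. U i \<omega>)) (count_space UNIV) g"
    by (subst distr_distr) (auto simp: comp_def g_restrict space_PiM)
  also have "\<dots> = distr ?N (count_space UNIV) (\<lambda>f. g (restrict f I))"
    unfolding law by (subst distr_distr) (auto simp: comp_def space_PiM)
  finally show ?thesis
    by (simp add: g_restrict map_pmf_rep_eq)
qed

lemma attachment_forest_restrict:
  "attachment_forest n (restrict u {1..n}) = attachment_forest n u"
  by (auto simp: attachment_forest_def)

lemma attachment_forest_in_digraphs_on: "attachment_forest n u \<in> digraphs_on n"
  by (auto simp: attachment_forest_def digraphs_on_def vertex_pairs_def)

lemma finite_digraphs_on: "finite (digraphs_on n)"
  by (simp add: digraphs_on_def)

lemma measurable_attachment_forest: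
  "attachment_forest n \<in> measurable (\<Pi>\<^sub>M l\<in>{1..n}. count_space UNIV) (count_space UNIV)"
proof -
  let ?P = "\<Pi>\<^sub>M l\<in>{1..n}. count_space (UNIV :: nat set)"
  have "attachment_forest n \<in> measurable ?P (count_space (digraphs_on n))"
    unfolding measurable_count_space_eq2[OF finite_digraphs_on]
  proof (intro conjI ballI)
    show "attachment_forest n \<in> space ?P \<rightarrow> digraphs_on n"
      using attachment_forest_in_digraphs_on by auto
    fix G assume "G \<in> digraphs_on n"
    then have "attachment_forest n u = G
        \<longleftrightarrow> (\<forall>l\<in>{1..n}. \<forall>k\<in>{1..n}. (k, l) \<in> G \<longleftrightarrow> k < l \<and> u l = k)" for u
      by (auto simp: attachment_forest_def digraphs_on_def vertex_pairs_def)
    then have "attachment_forest n -` {G} \<inter> space ?P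
        = {u \<in> space ?P. \<forall>l\<in>{1..n}. \<forall>k\<in>{1..n}. (k, l) \<in> G \<longleftrightarrow> k < l \<and> u l = k}"
      by auto
    also have "\<dots> \<in> sets ?P"
      by measurable
    finally show "attachment_forest n -` {G} \<inter> space ?P \<in> sets ?P" .
  qed
  then show ?thesis
    by (rule measurable_compose) simp
qed

theorem proposition2p1:
  fixes n :: nat
    and M :: "'a measure"
    and U :: "nat \<Rightarrow> 'a \<Rightarrow> nat"
    and \<sigma> :: "'a \<Rightarrow> nat \<Rightarrow> nat"
  assumes "n \<ge> 2"
    and "prob_space M"
    and "prob_space.indep_vars M (\<lambda>_. count_space UNIV) U {1..n}"
    and "\<And>l. l \<in> {1..n} \<Longrightarrow>
           distr M (count_space UNIV) (U l) = measure_pmf (pmf_of_set ({1..n} - {l}))"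
    and "distr M (count_space UNIV) \<sigma> = measure_pmf (pmf_of_set {p. p permutes {1..n}})"
    and "prob_space.indep_rvs M
           (count_space UNIV) (\<lambda>\<omega>. attachment_forest n (\<lambda>l. U l \<omega>))
           (count_space UNIV) \<sigma>"
  shows "distr M (count_space UNIV) (\<lambda>\<omega>. relabel (\<sigma> \<omega>) (attachment_forest n (\<lambda>l. U l \<omega>)))
           = measure_pmf (moran_forest n)"
proof -
  interpret prob_space M by fact
  have "distr M (count_space UNIV) (\<lambda>\<omega>. attachment_forest n (\<lambda>l. U l \<omega>))
      = measure_pmf (map_pmf (attachment_forest n) (uniform_mothers n))"
    unfolding uniform_mothers_def
    by (rule distr_independent_eq_Pi_pmf)
      (use assms measurable_attachment_forest attachment_forest_restrict in auto)
  then have "distr M (count_space UNIV) (\<lambda>\<omega>. relabel (\<sigma> \<omega>) (attachment_forest n (\<lambda>l. U l \<omega>)))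
      = measure_pmf (bind_pmf (map_pmf (attachment_forest n) (uniform_mothers n))
           (\<lambda>G. map_pmf (\<lambda>p. relabel p G) (uniform_ranking n)))"
    using assms(5,6) finite_digraphs_on attachment_forest_in_digraphs_on
    unfolding uniform_ranking_def
    by (intro distr_of_independent_pair[where f = "\<lambda>G p. relabel p G" and C = "digraphs_on n"]) auto
  then show ?thesis
    using assms(1) by (simp add: relabel_attachment_law moran_forest_eq_ranked_forest_law)
qed

end
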